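(* Let $(\Omega,\mathcal A,P)$ be a probability space, let $(\Omega_i,\mathcal A_i)$, $i=1,2,3$, be measurable spaces, and let $M_i$ be a Markov kernel from $(\Omega,\mathcal A,P)$ to $(\Omega_i,\mathcal A_i)$, $i=1,2,3$, such that the conditional distributions $P^{M_1|M_3}$, $P^{M_2|M_3}$ and $P^{M_1\times M_2|M_3}$ exist. Consider the propositions: (i) $M_1$ and $M_2$ are conditionally independent given $M_3$ (with respect to $P$). (ii) $M_1$ and $M_2$ are independent (with respect to $P$). (iii) The Markov kernels $P^{M_1|M_3}$ from $(\Omega_3,\mathcal A_3)$ to $(\Omega_1,\mathcal A_1)$ and $P^{M_2|M_3}$ from $(\Omega_3,\mathcal A_3)$ to $(\Omega_2,\mathcal A_2)$ are independent with respect to $P^{M_3}$. Then, under (i), the propositions (ii) and (iii) are equivalent.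
   Context: The symbol $\times$ denotes products of $\sigma$-fields and of measures. Markov kernel: a Markov kernel $M$ from $(\Omega,\mathcal A)$ to $(\Omega_1,\mathcal A_1)$ is a map $M:\Omega\times\mathcal A_1\to[0,1]$ such that $M(\omega,\cdot)$ is a probability measure on $\mathcal A_1$ for every $\omega\in\Omega$ and $M(\cdot,A_1)$ is $\mathcal A$-measurable for every $A_1\in\mathcal A_1$. Diagonal product: for Markov kernels $M_1$ from $(\Omega,\mathcal A)$ to $(\Omega_1,\mathcal A_1)$ and $M_2$ from $(\Omega,\mathcal A)$ to $(\Omega_2,\mathcal A_2)$, $M_1\times M_2$ is the unique Markov kernel from $(\Omega,\mathcal A)$ to $(\Omega_1\times\Omega_2,\mathcal A_1\times\mathcal A_2)$ with $(M_1\times M_2)(\omega,A_1\times A_2)=M_1(\omega,A_1)\,M_2(\omega,A_2)$ for all $A_i\in\mathcal A_i$. Image of a kernel: for a probability measure $Q$ on $\mathcal A$ and a Markov kernel $M$ from $(\Omega,\mathcal A)$ to $(\Omega_1,\mathcal A_1)$, $Q^{M}(A_1):=\int_\Omega M(\omega,A_1)\,dQ(\omega)$, $A_1\in\mathcal A_1$. Independence of kernels: two Markov kernels $M_1,M_2$ on $(\Omega,\mathcal A,Q)$ are independent with respect to $Q$ if $Q^{M_1\times M_2}=Q^{M_1}\times Q^{M_2}$. Conditional distribution of a kernel given another: for Markov kernels $N_1,N_2$ from $(\Omega,\mathcal A,Q)$ to $(\Omega_1,\mathcal A_1)$ and $(\Omega_2,\mathcal A_2)$ respectively, the conditional distribution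 $Q^{N_1|N_2}$ of $N_1$ given $N_2$, when it exists, is a Markov kernel $L$ from $(\Omega_2,\mathcal A_2)$ to $(\Omega_1,\mathcal A_1)$ such that $\int_\Omega N_1(\omega,A_1)N_2(\omega,A_2)\,dQ(\omega)=\int_{A_2}L(\omega_2,A_1)\,dQ^{N_2}(\omega_2)$ for all $A_1\in\mathcal A_1$, $A_2\in\mathcal A_2$. Conditional independence of kernels: $M_1$ and $M_2$ are conditionally independent given $M_3$ (with respect to $P$) if $P^{M_1\times M_2|M_3}=P^{M_1|M_3}\times P^{M_2|M_3}$, $P^{M_3}$-almost surely, the right-hand side being the diagonal product; equality of kernels almost surely is understood in the sense that for all $A_1\in\mathcal A_1$, $A_2\in\mathcal A_2$ the two kernels evaluated at $A_1\times A_2$ agree for $P^{M_3}$-almost every $\omega_3$. *)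

theory Defs
  imports "HOL-Probability.Probability"
begin

text \<open>
  A kernel from \<open>S\<close> to \<open>T\<close> is represented by a measure-valued function, so that
  \<open>measure (M \<omega>) A\<close> is the value written $M(\omega, A)$. Only the space and the
  \<open>\<sigma>\<close>-field of \<open>S\<close> and \<open>T\<close> matter. By \<open>markov_kernel_iff_measurable\<close> below, these are the
  measurable maps into the library's \<open>prob_algebra T\<close>.
\<close>

definition markov_kernel :: "'a measure \<Rightarrow> 'b measure \<Rightarrow> ('a \<Rightarrow> 'b measure) \<Rightarrow> bool" where
  "markov_kernel S T M \<longleftrightarrow>
     (\<forall>\<omega>\<in>space S. prob_space (M \<omega>) \<and> sets (M \<omega>) = sets T) \<and>
     (\<forall>A\<in>sets T. (\<lambda>\<omega>. measure (M \<omega>) A) \<in> borel_measurable S)"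

definition diagonal_product ::
    "('a \<Rightarrow> 'b measure) \<Rightarrow> ('a \<Rightarrow> 'c measure) \<Rightarrow> 'a \<Rightarrow> ('b \<times> 'c) measure" where
  "diagonal_product M1 M2 = (\<lambda>\<omega>. M1 \<omega> \<Otimes>\<^sub>M M2 \<omega>)"

text \<open>
  The monadic bind of the Giry monad; \<open>measure_kernel_image\<close> below gives the usual integral formula.
\<close>

definition kernel_image :: "'a measure \<Rightarrow> ('a \<Rightarrow> 'b measure) \<Rightarrow> 'b measure" where
  "kernel_image Q M = Q \<bind> M"

definition indep_kernels ::
    "'a measure \<Rightarrow> ('a \<Rightarrow> 'b measure) \<Rightarrow> ('a \<Rightarrow> 'c measure) \<Rightarrow> bool" where
  "indep_kernels Q M1 M2 \<longleftrightarrow>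
     kernel_image Q (diagonal_product M1 M2) = kernel_image Q M1 \<Otimes>\<^sub>M kernel_image Q M2"

text \<open>
  \<open>is_cond_distr Q N1 T1 N2 T2 L\<close> says that \<open>L\<close> is a version of the conditional distribution
  of \<open>N1\<close> (with values in \<open>T1\<close>) given \<open>N2\<close> (with values in \<open>T2\<close>). It is a relation because such
  a kernel need not exist and is only determined almost surely.
\<close>

definition is_cond_distr ::
    "'a measure \<Rightarrow> ('a \<Rightarrow> 'b measure) \<Rightarrow> 'b measure \<Rightarrow> ('a \<Rightarrow> 'c measure) \<Rightarrow> 'c measure \<Rightarrow>
     ('c \<Rightarrow> 'b measure) \<Rightarrow> bool" where
  "is_cond_distr Q N1 T1 N2 T2 L \<longleftrightarrow>
     markov_kernel T2 T1 L \<and>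
     (\<forall>A1\<in>sets T1. \<forall>A2\<in>sets T2.
        (LINT \<omega>|Q. measure (N1 \<omega>) A1 * measure (N2 \<omega>) A2) =
        (LINT \<omega>2:A2|kernel_image Q N2. measure (L \<omega>2) A1))"

text \<open>
  Almost sure equality of kernels into a product space, with an exceptional null set
  that may depend on the rectangle.
\<close>

definition kernel_AE_eq ::
    "'a measure \<Rightarrow> 'b measure \<Rightarrow> 'c measure \<Rightarrow> ('a \<Rightarrow> ('b \<times> 'c) measure) \<Rightarrow>
     ('a \<Rightarrow> ('b \<times> 'c) measure) \<Rightarrow> bool" where
  "kernel_AE_eq Q T1 T2 K L \<longleftrightarrow>
     (\<forall>A1\<in>sets T1. \<forall>A2\<in>sets T2.
        AE \<omega> in Q. measure (K \<omega>) (A1 \<times> A2) = measure (L \<omega>) (A1 \<times> A2))"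

text \<open>
  The choice of the versions \<open>L1\<close>, \<open>L2\<close>, \<open>L12\<close> is immaterial, see \<open>cond_indep_kernels_iff\<close> below.
\<close>

definition cond_indep_kernels ::
    "'a measure \<Rightarrow> ('a \<Rightarrow> 'b measure) \<Rightarrow> 'b measure \<Rightarrow> ('a \<Rightarrow> 'c measure) \<Rightarrow> 'c measure \<Rightarrow>
     ('a \<Rightarrow> 'd measure) \<Rightarrow> 'd measure \<Rightarrow> bool" where
  "cond_indep_kernels P M1 T1 M2 T2 M3 T3 \<longleftrightarrow>
     (\<exists>L1 L2 L12.
        is_cond_distr P M1 T1 M3 T3 L1 \<and>
        is_cond_distr P M2 T2 M3 T3 L2 \<and>
        is_cond_distr P (diagonal_product M1 M2) (T1 \<Otimes>\<^sub>M T2) M3 T3 L12 \<and>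
        kernel_AE_eq (kernel_image P M3) T1 T2 L12 (diagonal_product L1 L2))"


lemma markov_kernel_iff_measurable:
  "markov_kernel S T M \<longleftrightarrow> M \<in> S \<rightarrow>\<^sub>M prob_algebra T"
proof
  assume K: "markov_kernel S T M"
  show "M \<in> S \<rightarrow>\<^sub>M prob_algebra T"
  proof (rule measurable_prob_algebraI)
    show "\<And>x. x \<in> space S \<Longrightarrow> prob_space (M x)"
      using K by (auto simp: markov_kernel_def)
    show "M \<in> S \<rightarrow>\<^sub>M subprob_algebra T"
    proof (rule measurable_subprob_algebra)
      show "\<And>a. a \<in> space S \<Longrightarrow> subprob_space (M a)" "\<And>a. a \<in> space S \<Longrightarrow> sets (M a) = sets T"
        using K by (auto simp: markov_kernel_def prob_space_imp_subprob_space)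
      fix A assume "A \<in> sets T"
      then have "(\<lambda>\<omega>. ennreal (measure (M \<omega>) A)) \<in> borel_measurable S"
        using K by (auto simp: markov_kernel_def)
      then show "(\<lambda>a. emeasure (M a) A) \<in> borel_measurable S"
      proof (rule measurable_cong[THEN iffD1, rotated])
        fix w assume "w \<in> space S"
        then interpret prob_space "M w" using K by (auto simp: markov_kernel_def)
        show "ennreal (measure (M w) A) = emeasure (M w) A" by (simp add: emeasure_eq_measure)
      qed
    qed
  qed
next
  assume M[measurable]: "M \<in> S \<rightarrow>\<^sub>M prob_algebra T"
  have "M \<in> S \<rightarrow>\<^sub>M subprob_algebra T"
    using M by (rule measurable_prob_algebraD)
  then have "(\<lambda>\<omega>. measure (M \<omega>) A) \<in> borel_measurable S" if "A \<in> sets T" for A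
    using measurable_compose[OF _ measurable_measure_subprob_algebra[OF that]] by blast
  then show "markov_kernel S T M"
    using measurable_space[OF M] by (auto simp: markov_kernel_def space_prob_algebra)
qed

lemma markov_kernel_diagonal_product:
  assumes "markov_kernel S T1 M1" "markov_kernel S T2 M2"
  shows "markov_kernel S (T1 \<Otimes>\<^sub>M T2) (diagonal_product M1 M2)"
  using assms unfolding markov_kernel_iff_measurable diagonal_product_def
  by (rule measurable_pair_prob)

lemma measure_diagonal_product:
  assumes "markov_kernel S T1 M1" "markov_kernel S T2 M2" "\<omega> \<in> space S"
    and "A1 \<in> sets T1" "A2 \<in> sets T2"
  shows "measure (diagonal_product M1 M2 \<omega>) (A1 \<times> A2) = measure (M1 \<omega>) A1 * measure (M2 \<omega>) A2"
proof -
  interpret p1: prob_space "M1 \<omega>" using assms by (auto simp: markov_kernel_def)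
  interpret p2: prob_space "M2 \<omega>" using assms by (auto simp: markov_kernel_def)
  have "A1 \<in> sets (M1 \<omega>)" "A2 \<in> sets (M2 \<omega>)" using assms by (auto simp: markov_kernel_def)
  then show ?thesis
    by (simp add: diagonal_product_def measure_def p2.emeasure_pair_measure_Times enn2real_mult)
qed

lemma
  assumes Q: "prob_space Q" and M: "markov_kernel Q T M"
  shows prob_space_kernel_image: "prob_space (kernel_image Q M)"
    and sets_kernel_image: "sets (kernel_image Q M) = sets T"
    and measure_kernel_image:
      "A \<in> sets T \<Longrightarrow> measure (kernel_image Q M) A = (LINT \<omega>|Q. measure (M \<omega>) A)"
proof -
  interpret prob_space Q by fact
  have M': "M \<in> Q \<rightarrow>\<^sub>M prob_algebra T" using M by (simp add: markov_kernel_iff_measurable)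
  note M'' = measurable_prob_algebraD[OF M']
  have Qs: "Q \<in> space (prob_algebra Q)" using Q by (simp add: space_prob_algebra)
  show "prob_space (kernel_image Q M)" "sets (kernel_image Q M) = sets T"
    using prob_space_bind'[OF Qs M'] sets_bind'[OF Qs M'] by (simp_all add: kernel_image_def)
  assume "A \<in> sets T"
  then show "measure (kernel_image Q M) A = (LINT \<omega>|Q. measure (M \<omega>) A)"
    unfolding kernel_image_def by (rule measure_bind[OF M''])
qed

text \<open>
  Conditional distributions of kernels are almost surely unique on each measurable set.
\<close>

lemma is_cond_distr_AE_unique:
  assumes P: "prob_space P" and N2: "markov_kernel P T2 N2"
    and L: "is_cond_distr P N1 T1 N2 T2 L" and L': "is_cond_distr P N1 T1 N2 T2 L'"
    and A: "A \<in> sets T1"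
  shows "AE w in kernel_image P N2. measure (L w) A = measure (L' w) A"
proof -
  let ?Q = "kernel_image P N2"
  interpret Q: prob_space ?Q using P N2 by (rule prob_space_kernel_image)
  have s: "sets ?Q = sets T2" using P N2 by (rule sets_kernel_image)
  have int: "integrable ?Q (\<lambda>w. measure (K w) A)" if K: "is_cond_distr P N1 T1 N2 T2 K" for K
  proof (rule Q.integrable_const_bound[where B=1])
    have "measure (K w) A \<le> 1" if "w \<in> space ?Q" for w
    proof -
      interpret prob_space "K w"
        using K that sets_eq_imp_space_eq[OF s] by (auto simp: is_cond_distr_def markov_kernel_def)
      show ?thesis by simp
    qed
    then show "AE w in ?Q. norm (measure (K w) A) \<le> 1" by (intro AE_I2) simp
    show "(\<lambda>w. measure (K w) A) \<in> borel_measurable ?Q"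
      unfolding measurable_cong_sets[OF s refl]
      using K A by (auto simp: is_cond_distr_def markov_kernel_def)
  qed
  show ?thesis
  proof (rule density_unique_real[OF int[OF L] int[OF L']])
    fix B assume "B \<in> sets ?Q"
    then show "(LINT w:B|?Q. measure (L w) A) = (LINT w:B|?Q. measure (L' w) A)"
      using L L' A s by (simp add: is_cond_distr_def)
  qed
qed

lemma cond_indep_kernels_iff:
  assumes P: "prob_space P" and M3: "markov_kernel P T3 M3"
    and L1: "is_cond_distr P M1 T1 M3 T3 L1"
    and L2: "is_cond_distr P M2 T2 M3 T3 L2"
    and L12: "is_cond_distr P (diagonal_product M1 M2) (T1 \<Otimes>\<^sub>M T2) M3 T3 L12"
  shows "cond_indep_kernels P M1 T1 M2 T2 M3 T3 \<longleftrightarrow>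
    kernel_AE_eq (kernel_image P M3) T1 T2 L12 (diagonal_product L1 L2)"
proof
  assume "cond_indep_kernels P M1 T1 M2 T2 M3 T3"
  then obtain K1 K2 K12 where
    K1: "is_cond_distr P M1 T1 M3 T3 K1" and K2: "is_cond_distr P M2 T2 M3 T3 K2"
    and K12: "is_cond_distr P (diagonal_product M1 M2) (T1 \<Otimes>\<^sub>M T2) M3 T3 K12"
    and eq: "kernel_AE_eq (kernel_image P M3) T1 T2 K12 (diagonal_product K1 K2)"
    by (auto simp: cond_indep_kernels_def)
  have sp: "space (kernel_image P M3) = space T3"
    using sets_kernel_image[OF P M3] by (rule sets_eq_imp_space_eq)
  have k: "markov_kernel T3 T1 K1" "markov_kernel T3 T2 K2"
          "markov_kernel T3 T1 L1" "markov_kernel T3 T2 L2"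
    using K1 K2 L1 L2 by (auto simp: is_cond_distr_def)
  show "kernel_AE_eq (kernel_image P M3) T1 T2 L12 (diagonal_product L1 L2)"
    unfolding kernel_AE_eq_def
  proof (intro ballI)
    fix A1 A2 assume A: "A1 \<in> sets T1" "A2 \<in> sets T2"
    have "AE w in kernel_image P M3. measure (K12 w) (A1 \<times> A2) =
        measure (diagonal_product K1 K2 w) (A1 \<times> A2)"
      using eq A by (simp add: kernel_AE_eq_def)
    moreover note is_cond_distr_AE_unique[OF P M3 K1 L1 A(1)]
      is_cond_distr_AE_unique[OF P M3 K2 L2 A(2)]
      is_cond_distr_AE_unique[OF P M3 K12 L12 pair_measureI[OF A]]
      AE_space[of "kernel_image P M3"]
    ultimately show "AE w in kernel_image P M3. measure (L12 w) (A1 \<times> A2) =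
        measure (diagonal_product L1 L2 w) (A1 \<times> A2)"
    proof eventually_elim
      case (elim w)
      then show ?case
        using measure_diagonal_product[OF k(1,2) _ A, of w]
          measure_diagonal_product[OF k(3,4) _ A, of w] by (simp add: sp)
    qed
  qed
next
  assume "kernel_AE_eq (kernel_image P M3) T1 T2 L12 (diagonal_product L1 L2)"
  with L1 L2 L12 show "cond_indep_kernels P M1 T1 M2 T2 M3 T3"
    unfolding cond_indep_kernels_def by blast
qed

end

theory Submission
  imports Defs
begin

text \<open>
  Averaging a conditional distribution of \<open>N\<close> given \<open>M3\<close> over the law $P^{M_3}$ of the conditioning
  kernel returns the unconditional law $P^N$ (\<open>kernel_image_cond_distr\<close>, the law of total
  probability). Applied to \<open>L1\<close> and \<open>L2\<close>, this identifies the product of marginals in (iii) with the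
  one in (ii). Applied to \<open>L12\<close>, it expresses the joint law $P^{M_1 \times M_2}$ as the average of
  \<open>L12\<close>. Conditional independence permits replacing \<open>L12\<close> there by the diagonal product of \<open>L1\<close> and
  \<open>L2\<close>: the exceptional null sets depend on the rectangle, but an average only needs to be compared on
  one rectangle at a time, and rectangles determine a finite measure on the product
  (\<open>kernel_image_cong_kernel_AE_eq\<close>). Hence, under (i), the equations (ii) and (iii) have the same
  left-hand sides and the same right-hand sides.
\<close>

lemma markov_kernel_cong_sets:
  assumes "sets S = sets S'"
  shows "markov_kernel S T M \<longleftrightarrow> markov_kernel S' T M"
  unfolding markov_kernel_iff_measurable measurable_cong_sets[OF assms refl] ..

lemma prob_space_eqI_sets:
  assumes "prob_space M" "prob_space N" and s: "sets M = sets N"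
    and eq: "\<And>A. A \<in> sets N \<Longrightarrow> measure M A = measure N A"
  shows "M = N"
proof (rule measure_eqI[OF s])
  interpret M: prob_space M by fact
  interpret N: prob_space N by fact
  fix A assume "A \<in> sets M"
  then show "emeasure M A = emeasure N A"
    using eq s by (simp add: M.emeasure_eq_measure N.emeasure_eq_measure)
qed

lemma prob_space_eqI_rectangles:
  assumes "prob_space M" "prob_space N"
    and sM: "sets M = sets (T1 \<Otimes>\<^sub>M T2)" and sN: "sets N = sets (T1 \<Otimes>\<^sub>M T2)"
    and eq: "\<And>A B. A \<in> sets T1 \<Longrightarrow> B \<in> sets T2 \<Longrightarrow> measure M (A \<times> B) = measure N (A \<times> B)"
  shows "M = N"
proof -
  interpret M: prob_space M by fact
  interpret N: prob_space N by fact
  let ?E = "{A \<times> B |A B. A \<in> sets T1 \<and> B \<in> sets T2}"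
  let ?\<Omega> = "space T1 \<times> space T2"
  show ?thesis
  proof (rule measure_eqI_generator_eq)
    show "Int_stable ?E" by (rule Int_stable_pair_measure_generator)
    show "?E \<subseteq> Pow ?\<Omega>" by (rule pair_measure_closed)
    show "sets M = sigma_sets ?\<Omega> ?E" "sets N = sigma_sets ?\<Omega> ?E"
      by (simp_all add: sM sN sets_pair_measure)
    show "emeasure M X = emeasure N X" if "X \<in> ?E" for X
      using that eq by (auto simp: M.emeasure_eq_measure N.emeasure_eq_measure)
    show "range (\<lambda>_::nat. ?\<Omega>) \<subseteq> ?E" by auto
    show "(\<Union>_::nat. ?\<Omega>) = ?\<Omega>" by simp
    show "emeasure M ?\<Omega> \<noteq> \<infinity>" by simp
  qed
qed

text \<open>
  This is the defining equation of the conditional distribution for the event that the conditioning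
  kernel \<open>N2\<close> lies in the whole space, which carries no information.
\<close>

lemma kernel_image_cond_distr:
  assumes P: "prob_space P" and N1: "markov_kernel P T1 N1" and N2: "markov_kernel P T2 N2"
    and L: "is_cond_distr P N1 T1 N2 T2 L"
  shows "kernel_image (kernel_image P N2) L = kernel_image P N1"
proof -
  let ?Q = "kernel_image P N2"
  note Q = prob_space_kernel_image[OF P N2] and sQ = sets_kernel_image[OF P N2]
  have L': "markov_kernel ?Q T1 L"
    using L unfolding is_cond_distr_def markov_kernel_cong_sets[OF sQ] by simp
  show ?thesis
  proof (rule prob_space_eqI_sets)
    show "prob_space (kernel_image ?Q L)" by (rule prob_space_kernel_image[OF Q L'])
    show "prob_space (kernel_image P N1)" by (rule prob_space_kernel_image[OF P N1])
    show "sets (kernel_image ?Q L) = sets (kernel_image P N1)"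
      by (simp add: sets_kernel_image[OF Q L'] sets_kernel_image[OF P N1])
    fix A assume "A \<in> sets (kernel_image P N1)"
    then have A: "A \<in> sets T1" by (simp add: sets_kernel_image[OF P N1])
    have full: "measure (N2 w) (space T2) = 1" if "w \<in> space P" for w
    proof -
      interpret prob_space "N2 w" using N2 that by (auto simp: markov_kernel_def)
      have "space (N2 w) = space T2"
        using N2 that by (intro sets_eq_imp_space_eq) (auto simp: markov_kernel_def)
      then show ?thesis using prob_space by simp
    qed
    have "measure (kernel_image ?Q L) A = (LINT w|?Q. measure (L w) A)"
      by (rule measure_kernel_image[OF Q L' A])
    also have "\<dots> = (LINT w:space T2|?Q. measure (L w) A)"
      unfolding set_lebesgue_integral_def
      by (rule Bochner_Integration.integral_cong) (simp_all add: sets_eq_imp_space_eq[OF sQ])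
    also have "\<dots> = (LINT w|P. measure (N1 w) A * measure (N2 w) (space T2))"
      using L A by (simp add: is_cond_distr_def)
    also have "\<dots> = (LINT w|P. measure (N1 w) A)"
      by (rule Bochner_Integration.integral_cong) (simp_all add: full)
    also have "\<dots> = measure (kernel_image P N1) A"
      by (rule measure_kernel_image[OF P N1 A, symmetric])
    finally show "measure (kernel_image ?Q L) A = measure (kernel_image P N1) A" .
  qed
qed

text \<open>
  There need not be a single null set outside of which the two kernels agree as measures, so the
  agreement is integrated rectangle by rectangle, and only the averages are extended to the whole
  product \<open>\<sigma>\<close>-field.
\<close>

lemma kernel_image_cong_kernel_AE_eq:
  assumes Q: "prob_space Q"
    and K: "markov_kernel Q (T1 \<Otimes>\<^sub>M T2) K" and L: "markov_kernel Q (T1 \<Otimes>\<^sub>M T2) L"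
    and eq: "kernel_AE_eq Q T1 T2 K L"
  shows "kernel_image Q K = kernel_image Q L"
proof (rule prob_space_eqI_rectangles)
  show "prob_space (kernel_image Q K)" "prob_space (kernel_image Q L)"
    using prob_space_kernel_image[OF Q K] prob_space_kernel_image[OF Q L] .
  show "sets (kernel_image Q K) = sets (T1 \<Otimes>\<^sub>M T2)" "sets (kernel_image Q L) = sets (T1 \<Otimes>\<^sub>M T2)"
    using sets_kernel_image[OF Q K] sets_kernel_image[OF Q L] .
  fix A B assume A: "A \<in> sets T1" and B: "B \<in> sets T2"
  then have AB: "A \<times> B \<in> sets (T1 \<Otimes>\<^sub>M T2)" by simp
  have "(LINT w|Q. measure (K w) (A \<times> B)) = (LINT w|Q. measure (L w) (A \<times> B))"
    using K L eq A B AB by (intro integral_cong_AE) (auto simp: markov_kernel_def kernel_AE_eq_def)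
  then show "measure (kernel_image Q K) (A \<times> B) = measure (kernel_image Q L) (A \<times> B)"
    by (simp add: measure_kernel_image[OF Q K AB] measure_kernel_image[OF Q L AB])
qed

theorem theorem2:
  fixes P :: "'a measure"
    and T1 :: "'b measure" and T2 :: "'c measure" and T3 :: "'d measure"
    and M1 :: "'a \<Rightarrow> 'b measure" and M2 :: "'a \<Rightarrow> 'c measure" and M3 :: "'a \<Rightarrow> 'd measure"
    and L1 :: "'d \<Rightarrow> 'b measure" and L2 :: "'d \<Rightarrow> 'c measure"
    and L12 :: "'d \<Rightarrow> ('b \<times> 'c) measure"
  assumes "prob_space P"
    and "markov_kernel P T1 M1" and "markov_kernel P T2 M2" and "markov_kernel P T3 M3"
    and "is_cond_distr P M1 T1 M3 T3 L1"
    and "is_cond_distr P M2 T2 M3 T3 L2"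
    and "is_cond_distr P (diagonal_product M1 M2) (T1 \<Otimes>\<^sub>M T2) M3 T3 L12"
    and "cond_indep_kernels P M1 T1 M2 T2 M3 T3"
  shows "indep_kernels P M1 M2 \<longleftrightarrow> indep_kernels (kernel_image P M3) L1 L2"
proof -
  let ?Q = "kernel_image P M3"
  note P = assms(1) and M = assms(2-4) and L = assms(5-7)
  note Q = prob_space_kernel_image[OF P M(3)] and sQ = sets_kernel_image[OF P M(3)]
  have kernels: "markov_kernel ?Q T1 L1" "markov_kernel ?Q T2 L2"
      "markov_kernel ?Q (T1 \<Otimes>\<^sub>M T2) L12"
    using L unfolding is_cond_distr_def markov_kernel_cong_sets[OF sQ] by simp_all
  \<comment> \<open>Conditional independence is given for some versions of the conditional distributions; it is
    transferred to the versions at hand.\<close>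
  have "kernel_AE_eq ?Q T1 T2 L12 (diagonal_product L1 L2)"
    using assms(8) cond_indep_kernels_iff[OF P M(3) L] by simp
  then have "kernel_image ?Q (diagonal_product L1 L2) = kernel_image ?Q L12"
    using kernel_image_cong_kernel_AE_eq[OF Q kernels(3)
        markov_kernel_diagonal_product[OF kernels(1,2)]] by simp
  also have "\<dots> = kernel_image P (diagonal_product M1 M2)"
    by (rule kernel_image_cond_distr[OF P markov_kernel_diagonal_product[OF M(1,2)] M(3) L(3)])
  finally have joint: "kernel_image ?Q (diagonal_product L1 L2) =
      kernel_image P (diagonal_product M1 M2)" .
  have "kernel_image ?Q L1 = kernel_image P M1" "kernel_image ?Q L2 = kernel_image P M2"
    using kernel_image_cond_distr[OF P M(1,3) L(1)] kernel_image_cond_distr[OF P M(2,3) L(2)] .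
  with joint show ?thesis by (simp add: indep_kernels_def)
qed

end
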